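(* For every $n\ge 1$ and $i\in\{1,2\}$, $s_i(n,\# P_6,S_4)=0$.
   Context: For graphs $F$ and $H$, the $F$-saturation game on $n$ vertices is played by Max and Mini, who alternately claim previously unclaimed edges of $K_n$ so that the graph $G$ of claimed edges stays $F$-free; the game ends when $G$ is $F$-saturated. The $H$-score is the number of (not necessarily induced) subgraphs of the final $G$ isomorphic to $H$. Max maximizes, Mini minimizes the score; $s_1(n,\# H,F)$ is the optimal score when Max starts, $s_2(n,\# H,F)$ when Mini starts. $P_6$ is the path on 6 vertices and $S_4$ the star on 4 vertices. *)

theory Defs
  imports "HOL-Library.Ramsey"
begin

(* A graph is a pair (vertex set, edge set); the edge set should consist of
   two-element subsets of the vertex set. *)
type_synonym 'a ugraph = "'a set \<times> 'a set set"

definition is_graph :: "'a ugraph \<Rightarrow> bool" where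
  "is_graph G \<longleftrightarrow> finite (fst G) \<and> snd G \<subseteq> nsets (fst G) 2"

definition is_subgraph :: "'a ugraph \<Rightarrow> 'a ugraph \<Rightarrow> bool" where
  "is_subgraph H G \<longleftrightarrow> is_graph H \<and> fst H \<subseteq> fst G \<and> snd H \<subseteq> snd G"

definition graph_iso :: "'a ugraph \<Rightarrow> 'b ugraph \<Rightarrow> bool" where
  "graph_iso G H \<longleftrightarrow>
     (\<exists>f. bij_betw f (fst G) (fst H) \<and> (\<lambda>e. f ` e) ` snd G = snd H)"

definition num_copies :: "'b ugraph \<Rightarrow> 'a ugraph \<Rightarrow> nat" where
  "num_copies H G = card {H'. is_subgraph H' G \<and> graph_iso H H'}"

definition graph_free :: "'b ugraph \<Rightarrow> 'a ugraph \<Rightarrow> bool" where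
  "graph_free F G \<longleftrightarrow> \<not> (\<exists>F'. is_subgraph F' G \<and> graph_iso F F')"

definition add_edge :: "'a set \<Rightarrow> 'a ugraph \<Rightarrow> 'a ugraph" where
  "add_edge e G = (fst G, insert e (snd G))"

definition saturated :: "'b ugraph \<Rightarrow> 'a ugraph \<Rightarrow> bool" where
  "saturated F G \<longleftrightarrow> graph_free F G \<and>
     (\<forall>e \<in> nsets (fst G) 2 - snd G. \<not> graph_free F (add_edge e G))"

definition legal_moves :: "'b ugraph \<Rightarrow> 'a ugraph \<Rightarrow> 'a set set" where
  "legal_moves F G = {e \<in> nsets (fst G) 2 - snd G. graph_free F (add_edge e G)}"

lemma legal_move_decreases:
  assumes "e \<in> legal_moves F (V, E)" and "finite V"
  shows "card (nsets (fst (add_edge e (V, E))) 2 - snd (add_edge e (V, E)))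
    < card (nsets V 2 - E)"
proof (rule psubset_card_mono)
  show "finite (nsets V 2 - E)"
    using assms(2) by (simp add: finite_imp_finite_nsets)
  show "nsets (fst (add_edge e (V, E))) 2 - snd (add_edge e (V, E)) \<subset> nsets V 2 - E"
    using assms(1) by (auto simp: legal_moves_def add_edge_def)
qed

datatype player = Max_player | Mini_player

fun opponent :: "player \<Rightarrow> player" where
  "opponent Max_player = Mini_player"
| "opponent Mini_player = Max_player"

(* The H-score of the final position under optimal play from position G with player p
   to move. Every F-free position is either F-saturated or has a legal move, so Max and
   Min below are applied to nonempty sets when G is F-free. The value 0 for infinite
   vertex sets only serves to make the recursion total. *)
function game_value ::
  "'b ugraph \<Rightarrow> 'c ugraph \<Rightarrow> player \<Rightarrow> 'a ugraph \<Rightarrow> nat" where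
  "game_value H F p G =
    (if infinite (fst G) then 0
     else if saturated F G then num_copies H G
     else (case p of
         Max_player \<Rightarrow>
           Max ((\<lambda>e. game_value H F (opponent p) (add_edge e G)) ` legal_moves F G)
       | Mini_player \<Rightarrow>
           Min ((\<lambda>e. game_value H F (opponent p) (add_edge e G)) ` legal_moves F G)))"
  by pat_completeness auto
termination
  by (relation "measure (\<lambda>(H, F, p, G). card (nsets (fst G) 2 - snd G))")
    (auto dest: legal_move_decreases)

declare game_value.simps [simp del]

definition empty_graph :: "nat \<Rightarrow> nat ugraph" where
  "empty_graph n = ({..<n}, {})"

(* sat_score i n H F is the optimal score s_i(n, #H, F); only i = 1 and i = 2 are meaningful. *)
definition sat_score :: "nat \<Rightarrow> nat \<Rightarrow> 'b ugraph \<Rightarrow> 'c ugraph \<Rightarrow> nat" where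
  "sat_score i n H F = game_value H F (if i = 1 then Max_player else Mini_player) (empty_graph n)"

definition path_graph :: "nat \<Rightarrow> nat ugraph" where
  "path_graph k = ({..<k}, {{i, Suc i} | i. Suc i < k})"

(* The star on k vertices: the centre 0 is joined to k - 1 leaves. *)
definition star_graph :: "nat \<Rightarrow> nat ugraph" where
  "star_graph k = ({..<k}, {{0, i} | i. 0 < i \<and> i < k})"

end

theory Submission
  imports Defs
begin

text \<open>
  An \<open>S\<^sub>4\<close>-free graph has maximum degree 2, so its components are paths and cycles. After
  each of her moves Mini keeps every component on at most five vertices, with at most one path that
  has an edge, and that path on at most four vertices. If Max extends the path or leaves it with at
  least three vertices, Mini closes it to a cycle; if Max leaves two disjoint edges as the only
  nontrivial paths, Mini joins them; a single edge she extends, and if all paths are trivial she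
  plays a new edge. Paths and cycles never need to be constructed: it suffices to track the set of
  vertices of degree 1, which each move changes by symmetric difference with the played edge, and
  bounded sets of vertices that no edge leaves.
\<close>

section \<open>Degrees, path ends and the invariants\<close>

definition claw_free :: "'a set set \<Rightarrow> bool" where
  "claw_free E \<longleftrightarrow>
     \<not> (\<exists>v a b c. a \<noteq> b \<and> a \<noteq> c \<and> b \<noteq> c \<and> {v, a} \<in> E \<and> {v, b} \<in> E \<and> {v, c} \<in> E)"

text \<open>In a claw-free simple graph these are the vertices of degree exactly 2, where no further
  edge may be played.\<close>

definition full :: "'a set set \<Rightarrow> 'a \<Rightarrow> bool" where
  "full E v \<longleftrightarrow> (\<exists>a b. a \<noteq> b \<and> {v, a} \<in> E \<and> {v, b} \<in> E)"

text \<open>In a simple graph these are the vertices of degree 1.\<close>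

definition ends :: "'a set set \<Rightarrow> 'a set" where
  "ends E = {v. (\<exists>a. {v, a} \<in> E) \<and> \<not> full E v}"

text \<open>Such a \<open>K\<close> is a union of connected components, up to points outside the
  graph. It stands in for a component without any notion of connectivity.\<close>

definition edge_closed :: "'a set set \<Rightarrow> 'a set \<Rightarrow> bool" where
  "edge_closed E K \<longleftrightarrow> (\<forall>e\<in>E. e \<inter> K \<noteq> {} \<longrightarrow> e \<subseteq> K)"

definition joinable :: "'a set \<Rightarrow> 'a set set \<Rightarrow> 'a \<Rightarrow> 'a \<Rightarrow> bool" where
  "joinable V E u v \<longleftrightarrow>
     u \<in> V \<and> v \<in> V \<and> u \<noteq> v \<and> {u, v} \<notin> E \<and> \<not> full E u \<and> \<not> full E v"

text \<open>The invariant kept after the moves of both players; closed sets of five vertices have no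
  room for a path on six.\<close>

definition tame :: "'a set \<Rightarrow> 'a set set \<Rightarrow> bool" where
  "tame V E \<longleftrightarrow> is_graph (V, E) \<and> claw_free E \<and>
     (\<forall>v\<in>V. \<exists>K. v \<in> K \<and> finite K \<and> card K \<le> 5 \<and> edge_closed E K)"

text \<open>The positions Mini hands to Max. The bound 4 lets Max add one vertex to the path without
  breaking the bound 5 of \<open>tame\<close>.\<close>

definition safe :: "'a set \<Rightarrow> 'a set set \<Rightarrow> bool" where
  "safe V E \<longleftrightarrow> tame V E \<and>
     (ends E = {} \<or>
      (\<exists>s t K. s \<noteq> t \<and> ends E = {s, t} \<and> {s, t} \<subseteq> K \<and> finite K \<and> card K \<le> 4 \<and> edge_closed E K))"

section \<open>Legal moves as a degree condition\<close>

lemma nsets_2_iff: "e \<in> nsets V 2 \<longleftrightarrow> (\<exists>u v. e = {u, v} \<and> u \<in> V \<and> v \<in> V \<and> u \<noteq> v)"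
  by (auto simp: nsets_def card_2_iff)

lemma is_graph_edge:
  assumes "is_graph (V, E)" "{u, v} \<in> E"
  shows "u \<in> V \<and> v \<in> V \<and> u \<noteq> v"
  using assms by (auto simp: is_graph_def nsets_2_iff subset_iff doubleton_eq_iff)

lemma is_graph_edge_at:
  assumes "is_graph (V, E)" "e \<in> E" "x \<in> e"
  obtains y where "e = {x, y}"
proof -
  have "e \<in> nsets V 2"
    using assms by (auto simp: is_graph_def)
  then obtain u v where "e = {u, v}"
    by (auto simp: nsets_2_iff)
  then show thesis
    using that[of u] that[of v] assms(3) by (auto simp: insert_commute)
qed

lemma is_graph_insert:
  assumes "is_graph (V, E)" "u \<in> V" "v \<in> V" "u \<noteq> v"
  shows "is_graph (V, insert {u, v} E)"
  using assms by (auto simp: is_graph_def nsets_2_iff)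

text \<open>Edges of a graph are not loops, so a claw spans four distinct vertices and is a copy of
  the star; conversely, an embedded star maps its three edges to a claw.\<close>

lemma star_free_iff_claw_free:
  assumes "is_graph (V, E)"
  shows "graph_free (star_graph 4) (V, E) \<longleftrightarrow> claw_free E"
proof
  assume free: "graph_free (star_graph 4) (V, E)"
  show "claw_free E"
    unfolding claw_free_def
  proof clarify
    fix v a b c
    assume ne: "a \<noteq> b" "a \<noteq> c" "b \<noteq> c" and E: "{v, a} \<in> E" "{v, b} \<in> E" "{v, c} \<in> E"
    define F where "F = ({v, a, b, c}, {{v, a}, {v, b}, {v, c}})"
    define f where "f i = [v, a, b, c] ! i" for i
    have V: "v \<in> V" "a \<in> V" "b \<in> V" "c \<in> V" "v \<noteq> a" "v \<noteq> b" "v \<noteq> c"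
      using is_graph_edge[OF assms] E by blast+
    have "is_graph F"
      using V by (auto simp: F_def is_graph_def nsets_2_iff)
    then have "is_subgraph F (V, E)"
      using V E by (auto simp: F_def is_subgraph_def)
    moreover have "graph_iso (star_graph 4) F"
      unfolding graph_iso_def
    proof (intro exI conjI)
      have "bij_betw ((!) [v, a, b, c]) {..<4} {v, a, b, c}"
        using V ne by (intro bij_betw_nth) auto
      then show "bij_betw f (fst (star_graph 4)) (fst F)"
        by (simp add: F_def star_graph_def f_def[abs_def])
      have "{i. 0 < i \<and> i < (4::nat)} = {1, 2, 3}"
        by auto
      then have "{{0, i} |i. 0 < i \<and> i < 4} = {{0, 1}, {0, 2}, {0, 3::nat}}"
        by (simp add: setcompr_eq_image)
      then show "(\<lambda>e. f ` e) ` snd (star_graph 4) = snd F"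
        by (simp add: F_def star_graph_def f_def)
    qed
    ultimately show False
      using free unfolding graph_free_def by blast
  qed
next
  assume claw: "claw_free E"
  show "graph_free (star_graph 4) (V, E)"
    unfolding graph_free_def
  proof clarify
    fix A B
    assume sub: "is_subgraph (A, B) (V, E)" and "graph_iso (star_graph 4) (A, B)"
    then obtain f where bij: "bij_betw f {..<4::nat} A"
      and im: "(\<lambda>e. f ` e) ` {{0, i} |i. 0 < i \<and> i < (4::nat)} = B"
      by (auto simp: graph_iso_def star_graph_def)
    have edge: "f ` {0, i} \<in> E" if "0 < i" "i < 4" for i
    proof -
      have "{0, i} \<in> {{0, i} |i. 0 < i \<and> i < 4}"
        using that by blast
      then have "f ` {0, i} \<in> B"
        unfolding im[symmetric] by (rule imageI)
      then show ?thesis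
        using sub by (auto simp: is_subgraph_def)
    qed
    have "{f 0, f 1} \<in> E" "{f 0, f 2} \<in> E" "{f 0, f 3} \<in> E"
      using edge[of 1] edge[of 2] edge[of 3] by simp_all
    moreover have "inj_on f {..<4}"
      using bij by (simp add: bij_betw_def)
    then have "f 1 \<noteq> f 2" "f 1 \<noteq> f 3" "f 2 \<noteq> f 3"
      by (auto dest: inj_onD)
    ultimately show False
      using claw unfolding claw_free_def by blast
  qed
qed

text \<open>A new claw must use the new edge, so its centre is \<open>u\<close> or \<open>v\<close>
  and already has two old edges.\<close>

lemma claw_free_insert_iff:
  assumes "claw_free E" "u \<noteq> v" "{u, v} \<notin> E"
  shows "claw_free (insert {u, v} E) \<longleftrightarrow> \<not> full E u \<and> \<not> full E v"
proof
  assume claw: "claw_free (insert {u, v} E)"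
  have False if "full E x" "{x, y} = {u, v}" for x y
  proof -
    obtain a b where "a \<noteq> b" "{x, a} \<in> E" "{x, b} \<in> E"
      using \<open>full E x\<close> by (auto simp: full_def)
    \<comment> \<open>The pair \<open>{x, y}\<close> was not an edge before, so \<open>y\<close> is
      a third leaf at \<open>x\<close>.\<close>
    moreover have "a \<noteq> y" "b \<noteq> y"
      using calculation assms(3) that(2) by metis+
    ultimately show False
      using claw that(2) unfolding claw_free_def by blast
  qed
  then show "\<not> full E u \<and> \<not> full E v"
    by blast
next
  assume "\<not> full E u \<and> \<not> full E v"
  then show "claw_free (insert {u, v} E)"
    using assms unfolding claw_free_def full_def insert_iff doubleton_eq_iff by metis
qed

lemma legal_moves_eq:
  assumes "is_graph (V, E)" "claw_free E"
  shows "legal_moves (star_graph 4) (V, E) = {{u, v} |u v. joinable V E u v}"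
proof -
  have legal: "{u, v} \<in> legal_moves (star_graph 4) (V, E) \<longleftrightarrow> joinable V E u v"
    if "u \<in> V" "v \<in> V" "u \<noteq> v" for u v
    using that assms claw_free_insert_iff[of E u v]
      star_free_iff_claw_free[OF is_graph_insert[OF assms(1) that]]
    by (auto simp: legal_moves_def add_edge_def joinable_def nsets_2_iff)
  show ?thesis
  proof (intro set_eqI iffI)
    fix e
    assume e: "e \<in> legal_moves (star_graph 4) (V, E)"
    then obtain u v where "e = {u, v}" "u \<in> V" "v \<in> V" "u \<noteq> v"
      by (auto simp: legal_moves_def nsets_2_iff)
    then show "e \<in> {{u, v} |u v. joinable V E u v}"
      using e legal by blast
  next
    fix e
    assume "e \<in> {{u, v} |u v. joinable V E u v}"
    then obtain u v where "e = {u, v}" "joinable V E u v"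
      by blast
    then show "e \<in> legal_moves (star_graph 4) (V, E)"
      using legal[of u v] by (simp add: joinable_def)
  qed
qed

lemma saturated_iff_no_legal_moves:
  "graph_free F G \<Longrightarrow> saturated F G \<longleftrightarrow> legal_moves F G = {}"
  by (auto simp: saturated_def legal_moves_def)

section \<open>Bounded closed sets exclude the path on six vertices\<close>

lemma edge_closedD:
  assumes "edge_closed E K" "{x, y} \<in> E" "x \<in> K"
  shows "y \<in> K"
proof -
  have "{x, y} \<inter> K \<noteq> {}"
    using assms(3) by simp
  then have "{x, y} \<subseteq> K"
    using assms(1,2) unfolding edge_closed_def by metis
  then show ?thesis
    by simp
qed

text \<open>Following the path from its first vertex never leaves the closed set around that vertex,
  which cannot hold six distinct vertices.\<close>

lemma num_copies_path_6_eq_0: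
  assumes "tame V E"
  shows "num_copies (path_graph 6) (V, E) = 0"
proof -
  have False if sub: "is_subgraph H (V, E)" and iso: "graph_iso (path_graph 6) H" for H
  proof -
    obtain f where bij: "bij_betw f {..<6::nat} (fst H)"
      and im: "(\<lambda>e. f ` e) ` {{i, Suc i} |i. Suc i < (6::nat)} = snd H"
      using iso unfolding graph_iso_def path_graph_def fst_conv snd_conv by blast
    have edge: "{f i, f (Suc i)} \<in> E" if "Suc i < 6" for i
    proof -
      have "{i, Suc i} \<in> {{i, Suc i} |i. Suc i < 6}"
        using that by blast
      then have "f ` {i, Suc i} \<in> snd H"
        unfolding im[symmetric] by (rule imageI)
      then show ?thesis
        using sub by (auto simp: is_subgraph_def)
    qed
    have "f 0 \<in> V"
      using bij sub by (auto simp: is_subgraph_def bij_betw_def)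
    then obtain K where K: "f 0 \<in> K" "finite K" "card K \<le> 5" "edge_closed E K"
      using assms unfolding tame_def by blast
    have "f i \<in> K" if "i < 6" for i
      using that
    proof (induction i)
      case (Suc i)
      then show ?case
        using edge[of i] K(4) edge_closedD by auto
    qed (use K in simp)
    then have "card (f ` {..<6}) \<le> card K"
      using K by (intro card_mono) auto
    then show False
      using K card_image[OF bij_betw_imp_inj_on[OF bij]] by simp
  qed
  then have none: "{H. is_subgraph H (V, E) \<and> graph_iso (path_graph 6) H} = {}"
    by blast
  show ?thesis
    unfolding num_copies_def none by (rule card.empty)
qed

section \<open>Effect of a move on ends and closed sets\<close>

text \<open>At each endpoint the degree goes from 0 to 1 or from 1 to 2, so membership in
  \<open>ends\<close> toggles; all other vertices keep their edges.\<close>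

lemma ends_insert:
  assumes "joinable V E u v"
  shows "ends (insert {u, v} E) = sym_diff (ends E) {u, v}"
proof (rule set_eqI)
  fix w
  have *: "u \<noteq> v" "{u, v} \<notin> E" "{v, u} \<notin> E" "\<not> full E u" "\<not> full E v"
    using assms by (auto simp: joinable_def insert_commute)
  show "w \<in> ends (insert {u, v} E) \<longleftrightarrow> w \<in> sym_diff (ends E) {u, v}"
  proof (cases "w \<in> {u, v}")
    case False
    then have edge: "{w, a} \<in> insert {u, v} E \<longleftrightarrow> {w, a} \<in> E" for a
      by (auto simp: doubleton_eq_iff)
    show ?thesis
      using False by (simp only: ends_def full_def edge) auto
  next
    case True
    then obtain z where z: "{u, v} = {w, z}"
      by (metis insert_commute insertE singletonD)
    then have w: "\<not> full E w" "{w, z} \<notin> E"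
      using * True by auto
    have edge: "{w, a} \<in> insert {u, v} E \<longleftrightarrow> a = z \<or> {w, a} \<in> E" for a
      unfolding z insert_iff doubleton_eq_iff by blast
    \<comment> \<open>An endpoint is an end afterwards iff it was isolated before; as it was not
      full, this means it was not an end before.\<close>
    have "w \<in> ends (insert {u, v} E) \<longleftrightarrow> (\<forall>a. {w, a} \<notin> E)"
      using w(2) unfolding ends_def full_def mem_Collect_eq edge by metis
    then show ?thesis
      using True w(1) unfolding ends_def by blast
  qed
qed

lemma edge_closed_insert:
  "edge_closed E K \<Longrightarrow> u \<in> K \<longleftrightarrow> v \<in> K \<Longrightarrow> edge_closed (insert {u, v} E) K"
  by (auto simp: edge_closed_def)

lemma edge_closed_Un: "edge_closed E K \<Longrightarrow> edge_closed E L \<Longrightarrow> edge_closed E (K \<union> L)"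
  unfolding edge_closed_def by blast

text \<open>An edge meeting \<open>K - L\<close> lies in \<open>K\<close>; if it touched
  \<open>L\<close> it would lie inside \<open>L\<close>.\<close>

lemma edge_closed_Diff: "edge_closed E K \<Longrightarrow> edge_closed E L \<Longrightarrow> edge_closed E (K - L)"
  unfolding edge_closed_def by blast

text \<open>Neither an end nor full means degree 0.\<close>

lemma edge_closed_isolated:
  assumes "is_graph (V, E)" "u \<notin> ends E" "\<not> full E u"
  shows "edge_closed E {u}"
proof -
  have "{u, a} \<notin> E" for a
    using assms by (auto simp: ends_def)
  then have "u \<notin> e" if "e \<in> E" for e
    using is_graph_edge_at[OF assms(1) that] that by metis
  then show ?thesis
    by (simp add: edge_closed_def)
qed

text \<open>Neither endpoint has a second neighbour, so the edge is a component by itself.\<close>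

lemma edge_closed_pair:
  assumes "is_graph (V, E)" "{s, t} \<in> E" "\<not> full E s" "\<not> full E t"
  shows "edge_closed E {s, t}"
  unfolding edge_closed_def
proof (intro ballI impI)
  fix e
  assume "e \<in> E" "e \<inter> {s, t} \<noteq> {}"
  then obtain x y where "e = {x, y}" "x \<in> {s, t}"
    using is_graph_edge_at[OF assms(1)] by blast
  with \<open>e \<in> E\<close> show "e \<subseteq> {s, t}"
    using assms(2-4) unfolding full_def by (metis insertE insert_commute order_refl singletonD)
qed

text \<open>Vertices of \<open>K\<close> keep \<open>K\<close> as their bounded set. Any other
  vertex trades its set \<open>L\<close> for \<open>L - K\<close>, which avoids both ends of the new
  edge.\<close>

lemma tame_insert:
  assumes "tame V E" "joinable V E u v"
    and K: "edge_closed E K" "{u, v} \<subseteq> K" "finite K" "card K \<le> 5"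
  shows "tame V (insert {u, v} E)"
proof -
  have uv: "u \<in> V" "v \<in> V" "u \<noteq> v" "{u, v} \<notin> E" "\<not> full E u" "\<not> full E v"
    using assms(2) by (auto simp: joinable_def)
  have "\<exists>L. w \<in> L \<and> finite L \<and> card L \<le> 5 \<and> edge_closed (insert {u, v} E) L" if w: "w \<in> V" for w
  proof (cases "w \<in> K")
    case True
    moreover have "edge_closed (insert {u, v} E) K"
      using K by (intro edge_closed_insert) auto
    ultimately show ?thesis
      using K(3,4) by (intro exI[of _ K] conjI)
  next
    case False
    obtain L where L: "w \<in> L" "finite L" "card L \<le> 5" "edge_closed E L"
      using assms(1) w unfolding tame_def by blast
    have "card (L - K) \<le> 5"
      using L card_mono[of L "L - K"] by auto
    moreover have "edge_closed (insert {u, v} E) (L - K)"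
      using K L by (intro edge_closed_insert edge_closed_Diff) auto
    moreover have "w \<in> L - K" "finite (L - K)"
      using L False by auto
    ultimately show ?thesis
      by (intro exI[of _ "L - K"] conjI)
  qed
  then show ?thesis
    using assms(1) uv by (auto simp: tame_def is_graph_insert claw_free_insert_iff)
qed

lemma safe_insert:
  assumes "tame V E" "joinable V E u v" "sym_diff (ends E) {u, v} = {s, t}" "s \<noteq> t"
    and K: "edge_closed E K" "{u, v} \<subseteq> K" "{s, t} \<subseteq> K" "finite K" "card K \<le> 4"
  shows "safe V (insert {u, v} E)"
proof -
  have "tame V (insert {u, v} E)"
    using assms by (intro tame_insert[where K = K]) auto
  moreover have "edge_closed (insert {u, v} E) K"
    using K by (intro edge_closed_insert) auto
  ultimately show ?thesis
    using assms ends_insert[OF assms(2)] unfolding safe_def by metis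
qed

text \<open>Closing the only path leaves no ends, so only the bound 5 of \<open>tame\<close> has to
  hold.\<close>

lemma safe_insert_closing:
  assumes "tame V E" "joinable V E s t" "ends E = {s, t}"
    and K: "edge_closed E K" "{s, t} \<subseteq> K" "finite K" "card K \<le> 5"
  shows "safe V (insert {s, t} E)"
  using tame_insert[OF assms(1,2) K] ends_insert[OF assms(2)] assms(3)
  by (simp add: safe_def)

lemma ends_not_full: "v \<in> ends E \<Longrightarrow> \<not> full E v"
  by (simp add: ends_def)

lemma ends_in_graph: "is_graph (V, E) \<Longrightarrow> v \<in> ends E \<Longrightarrow> v \<in> V"
  by (auto simp: ends_def dest: is_graph_edge)

lemma joinable_ends:
  assumes "is_graph (V, E)" "s \<in> ends E" "t \<in> ends E" "s \<noteq> t" "{s, t} \<notin> E"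
  shows "joinable V E s t"
  using assms by (auto simp: joinable_def ends_not_full ends_in_graph)

lemma joinable_commute: "joinable V E u v \<longleftrightarrow> joinable V E v u"
  by (auto simp: joinable_def insert_commute)

text \<open>Being neither full nor an end, \<open>u\<close> is isolated, hence distinct from
  \<open>s\<close> and not adjacent to it.\<close>

lemma joinable_isolated:
  assumes "is_graph (V, E)" "joinable V E u v" "u \<notin> ends E" "s \<in> ends E"
  shows "joinable V E s u"
proof -
  have "{u, s} \<notin> E" "u \<in> V"
    using assms by (auto simp: ends_def joinable_def)
  then show ?thesis
    using assms by (auto simp: joinable_def ends_not_full ends_in_graph insert_commute)
qed

lemma edge_closed_isolated_pair:
  assumes "is_graph (V, E)" "joinable V E u v" "u \<notin> ends E" "v \<notin> ends E"
  shows "edge_closed E {u, v}"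
  unfolding insert_is_Un[of u "{v}"] using assms
  by (intro edge_closed_Un edge_closed_isolated[OF assms(1)]) (auto simp: joinable_def)

text \<open>Mini can move from an answerable position to a safe one, unless the game is over.\<close>

definition answerable :: "'a set \<Rightarrow> 'a set set \<Rightarrow> bool" where
  "answerable V E \<longleftrightarrow> tame V E \<and>
     ((\<exists>x y. joinable V E x y) \<longrightarrow>
      (\<exists>x y. joinable V E x y \<and> safe V (insert {x, y} E)))"

section \<open>Mini's replies, by the number of ends\<close>

text \<open>Without ends, every legal move joins two isolated vertices and creates the only path, so
  any move will do.\<close>

lemma answerable_no_ends:
  assumes "tame V E" "ends E = {}"
  shows "answerable V E"
proof -
  have "safe V (insert {x, y} E)" if "joinable V E x y" for x y
  proof (rule safe_insert[OF assms(1) that, of x y "{x, y}"])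
    show "edge_closed E {x, y}"
      using assms that by (intro edge_closed_isolated_pair) (auto simp: tame_def)
    show "x \<noteq> y"
      using that by (simp add: joinable_def)
    show "card {x, y} \<le> 4"
      by (simp add: card_insert_if)
  qed (use assms in auto)
  then show ?thesis
    using assms(1) by (auto simp: answerable_def)
qed

lemma answerable_two_ends:
  assumes "tame V E" "ends E = {s, t}" "s \<noteq> t"
    and K: "edge_closed E K" "{s, t} \<subseteq> K" "finite K" "card K \<le> 5"
  shows "answerable V E"
proof -
  have G: "is_graph (V, E)" and nf: "\<not> full E s" "\<not> full E t"
    using assms by (auto simp: tame_def ends_not_full)
  have "\<exists>a b. joinable V E a b \<and> safe V (insert {a, b} E)" if xy: "joinable V E x y" for x y
  proof (cases "{s, t} \<in> E")
    \<comment> \<open>The path has at least three vertices, so it can be closed to a cycle.\<close>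
    case False
    then have "joinable V E s t"
      using joinable_ends[OF G] assms by auto
    then show ?thesis
      using safe_insert_closing[OF assms(1) _ assms(2) K] by blast
  next
    case True
    \<comment> \<open>The path is a single edge. Its two ends are already joined, so any legal move
      involves a vertex that is no end, hence isolated; Mini extends the edge to it.\<close>
    obtain u z where u: "u \<notin> ends E" "joinable V E u z"
    proof (cases "x \<in> ends E \<and> y \<in> ends E")
      case True
      then have "{x, y} = {s, t}"
        using assms(2) xy by (auto simp: joinable_def)
      then show ?thesis
        using xy \<open>{s, t} \<in> E\<close> by (auto simp: joinable_def)
    next
      case False
      then show ?thesis
        using that xy joinable_commute by metis
    qed
    have su: "joinable V E s u"
      using joinable_isolated[OF G u(2,1)] assms(2) by auto
    have "u \<noteq> t" "u \<noteq> s"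
      using u assms(2) by auto
    have "safe V (insert {s, u} E)"
    proof (rule safe_insert[OF assms(1) su, of t u "{s, t} \<union> {u}"])
      show "edge_closed E ({s, t} \<union> {u})"
        using edge_closed_pair[OF G True nf] edge_closed_isolated[OF G u(1)] u(2)
        by (intro edge_closed_Un) (auto simp: joinable_def)
      show "sym_diff (ends E) {s, u} = {t, u}"
        using assms \<open>u \<noteq> t\<close> \<open>u \<noteq> s\<close> by auto
      show "card ({s, t} \<union> {u}) \<le> 4"
        by (simp add: card_insert_if)
    qed (use \<open>u \<noteq> t\<close> in auto)
    with su show ?thesis
      by blast
  qed
  then show ?thesis
    using assms(1) by (auto simp: answerable_def)
qed

text \<open>This is the position after Max has started a second path \<open>uv\<close> beside the
  path from \<open>s\<close> to \<open>t\<close>.\<close>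

lemma answerable_four_ends:
  assumes "tame V E" "ends E = {s, t, u, v}" "distinct [s, t, u, v]" "{u, v} \<in> E"
    and K: "edge_closed E K" "{s, t} \<subseteq> K" "finite K" "card K \<le> 5"
  shows "answerable V E"
proof -
  have G: "is_graph (V, E)" and nf: "\<not> full E s" "\<not> full E t" "\<not> full E u" "\<not> full E v"
    using assms by (auto simp: tame_def ends_not_full)
  have uv: "edge_closed E {u, v}"
    using edge_closed_pair[OF G assms(4)] nf by blast
  have "\<exists>a b. joinable V E a b \<and> safe V (insert {a, b} E)"
  proof (cases "{s, t} \<in> E")
    \<comment> \<open>Closing the older path leaves the edge \<open>uv\<close> as the only
      path.\<close>
    case False
    then have st: "joinable V E s t"
      using joinable_ends[OF G] assms by auto
    have "ends (insert {s, t} E) = {u, v}"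
      using ends_insert[OF st] assms by auto
    moreover have "edge_closed (insert {s, t} E) {u, v}"
      using uv assms by (intro edge_closed_insert) auto
    moreover have "card {u, v} \<le> 4"
      by (simp add: card_insert_if)
    moreover have "u \<noteq> v"
      using assms by simp
    ultimately have "safe V (insert {s, t} E)"
      using tame_insert[OF assms(1) st K] unfolding safe_def by blast
    with st show ?thesis
      by blast
  next
    case True
    then have st: "edge_closed E {s, t}"
      using edge_closed_pair[OF G True] nf by blast
    have "{s, u} \<notin> E"
    proof
      assume "{s, u} \<in> E"
      with st have "u \<in> {s, t}"
        by (rule edge_closedD) simp
      then show False
        using assms(3) by auto
    qed
    then have su: "joinable V E s u"
      using joinable_ends[OF G] assms by auto
    \<comment> \<open>Two disjoint edges become the path \<open>t, s, u, v\<close>, whose four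
      vertices meet the bound of \<open>safe\<close> exactly.\<close>
    have "safe V (insert {s, u} E)"
    proof (rule safe_insert[OF assms(1) su, of t v "{s, t} \<union> {u, v}"])
      show "edge_closed E ({s, t} \<union> {u, v})"
        using st uv by (rule edge_closed_Un)
      show "sym_diff (ends E) {s, u} = {t, v}"
        using assms by auto
      show "card ({s, t} \<union> {u, v}) \<le> 4"
        by (simp add: card_insert_if)
    qed (use assms in auto)
    with su show ?thesis
      by blast
  qed
  then show ?thesis
    using assms(1) by (auto simp: answerable_def)
qed

section \<open>Max's moves from safe positions\<close>

text \<open>The isolated vertex \<open>v\<close> enlarges \<open>K\<close> from at most 4 to at most
  5 vertices and replaces \<open>s\<close> as an end, which leaves two ends to answer.\<close>

lemma answerable_extension:
  assumes "tame V E" "joinable V E s v" "ends E = {s, t}" "s \<noteq> t" "v \<notin> ends E"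
    and K: "edge_closed E K" "{s, t} \<subseteq> K" "finite K" "card K \<le> 4"
  shows "answerable V (insert {s, v} E)"
proof (rule answerable_two_ends[where s = t and t = v and K = "K \<union> {v}"])
  have "edge_closed E {v}"
    using assms by (intro edge_closed_isolated) (auto simp: joinable_def tame_def)
  then have Kv: "edge_closed E (K \<union> {v})"
    using K by (intro edge_closed_Un)
  show card: "card (K \<union> {v}) \<le> 5"
    using K by (simp add: card_insert_if)
  show "tame V (insert {s, v} E)"
    using K by (intro tame_insert[OF assms(1,2) Kv] card) auto
  show "edge_closed (insert {s, v} E) (K \<union> {v})"
    using K by (intro edge_closed_insert Kv) auto
  show "ends (insert {s, v} E) = {t, v}"
    using ends_insert[OF assms(2)] assms(3-5) by auto
qed (use assms in auto)

text \<open>The cases count how many endpoints of Max's edge are ends: with none he starts a new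
  path, with one he extends the existing path, with two he closes it.\<close>

lemma safe_imp_answerable:
  assumes "safe V E" "joinable V E u v"
  shows "answerable V (insert {u, v} E)"
proof -
  have tame: "tame V E" and G: "is_graph (V, E)" and "u \<noteq> v"
    using assms by (auto simp: safe_def tame_def joinable_def)
  have card2: "card {u, v} \<le> 5"
    by (simp add: card_insert_if)
  have tame': "tame V (insert {u, v} E)" if "edge_closed E {u, v}"
    by (rule tame_insert[OF tame assms(2) that]) (simp_all add: card2)
  consider "ends E = {}"
    | s t K where "s \<noteq> t" "ends E = {s, t}" "edge_closed E K" "{s, t} \<subseteq> K" "finite K" "card K \<le> 4"
    using assms(1) unfolding safe_def by blast
  then show ?thesis
  proof cases
    case 1
    then have "edge_closed E {u, v}"
      using edge_closed_isolated_pair[OF G assms(2)] by simp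
    moreover have "ends (insert {u, v} E) = {u, v}"
      using ends_insert[OF assms(2)] 1 by simp
    ultimately show ?thesis
      using answerable_two_ends[of V "insert {u, v} E" u v "{u, v}"] tame' card2 \<open>u \<noteq> v\<close>
      by (simp add: edge_closed_insert)
  next
    case 2
    consider "u \<notin> ends E" "v \<notin> ends E" | "u \<in> ends E" "v \<notin> ends E"
      | "u \<notin> ends E" "v \<in> ends E" | "u \<in> ends E" "v \<in> ends E"
      by blast
    then show ?thesis
    proof cases
      case 1
      then have uv: "edge_closed E {u, v}"
        using edge_closed_isolated_pair[OF G assms(2)] by simp
      show ?thesis
      \<comment> \<open>\<open>K\<close> might contain just one of the isolated vertices
        \<open>u\<close>, \<open>v\<close>, and then the new edge would leave it. Removing both
        keeps it closed and still containing \<open>s\<close> and \<open>t\<close>.\<close>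
      proof (rule answerable_four_ends[where K = "K - {u, v}"])
        show "tame V (insert {u, v} E)"
          using uv by (rule tame')
        show "ends (insert {u, v} E) = {s, t, u, v}"
          using ends_insert[OF assms(2)] 1 2 by auto
        show "edge_closed (insert {u, v} E) (K - {u, v})"
          using 2 uv by (intro edge_closed_insert edge_closed_Diff) auto
        show "card (K - {u, v}) \<le> 5"
          using 2 card_mono[of K "K - {u, v}"] by auto
      qed (use 1 2 \<open>u \<noteq> v\<close> in auto)
    next
      case c: 2
      obtain t' where "ends E = {u, t'}" "u \<noteq> t'"
        using 2 c by (metis insertE insert_commute singletonD)
      then show ?thesis
        using answerable_extension[OF tame assms(2)] 2 c by auto
    next
      case c: 3
      obtain t' where "ends E = {v, t'}" "v \<noteq> t'"
        using 2 c by (metis insertE insert_commute singletonD)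
      then show ?thesis
        using answerable_extension[OF tame assms(2)[unfolded joinable_commute[of V E u v]]] 2 c
        by (auto simp: insert_commute)
    next
      case c: 4
      then have "ends E = {u, v}"
        using 2 \<open>u \<noteq> v\<close> by auto
      then have "safe V (insert {u, v} E)" "ends (insert {u, v} E) = {}"
        using safe_insert_closing[OF tame assms(2)] 2 ends_insert[OF assms(2)] by auto
      then show ?thesis
        by (auto simp: safe_def intro: answerable_no_ends)
    qed
  qed
qed

section \<open>Induction over the game\<close>

text \<open>Both players are treated together: Max leads from safe to answerable positions and Mini
  back again, while the number of unclaimed pairs drops. Every final position is tame and scores
  0.\<close>

lemma game_value_eq_0:
  assumes "p = Max_player \<and> safe V E \<or> p = Mini_player \<and> answerable V E"
  shows "game_value (path_graph 6) (star_graph 4) p (V, E) = 0"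
  using assms
proof (induction "card (nsets V 2 - E)" arbitrary: p E rule: less_induct)
  case less
  let ?F = "star_graph 4" and ?val = "game_value (path_graph 6) (star_graph 4)"
  let ?vals = "(\<lambda>e. ?val (opponent p) (add_edge e (V, E))) ` legal_moves ?F (V, E)"
  have tame: "tame V E"
    using less.prems by (auto simp: safe_def answerable_def)
  then have G: "is_graph (V, E)" and claw: "claw_free E" and fin: "finite V"
    by (auto simp: tame_def is_graph_def)
  have moves: "legal_moves ?F (V, E) = {{u, v} |u v. joinable V E u v}"
    using G claw by (rule legal_moves_eq)
  have sat: "saturated ?F (V, E) \<longleftrightarrow> legal_moves ?F (V, E) = {}"
    using G claw by (simp add: saturated_iff_no_legal_moves star_free_iff_claw_free)
  have IH: "?val q (add_edge {u, v} (V, E)) = 0"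
    if "joinable V E u v"
      and "q = Max_player \<and> safe V (insert {u, v} E) \<or> q = Mini_player \<and> answerable V (insert {u, v} E)"
    for q u v
  proof -
    have "{u, v} \<in> legal_moves ?F (V, E)"
      using that moves by auto
    from legal_move_decreases[OF this fin] show ?thesis
      using less.hyps[of "insert {u, v} E" q] that by (simp add: add_edge_def)
  qed
  have "finite (legal_moves ?F (V, E))"
    using fin by (auto simp: legal_moves_def finite_imp_finite_nsets)
  then have "finite ?vals"
    by simp
  show ?case
  proof (cases "legal_moves ?F (V, E) = {}")
    case True
    then show ?thesis
      using sat fin num_copies_path_6_eq_0[OF tame] by (subst game_value.simps) simp
  next
    case False
    then have rec: "?val p (V, E) = (case p of Max_player \<Rightarrow> Max ?vals | Mini_player \<Rightarrow> Min ?vals)"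
      using sat fin by (subst game_value.simps) simp
    show ?thesis
    proof (cases p)
      case Max_player
      then have "safe V E"
        using less.prems by simp
      \<comment> \<open>Whatever Max plays is answerable, so every option has value 0.\<close>
      have "x = 0" if "x \<in> ?vals" for x
      proof -
        obtain u v where "joinable V E u v" "x = ?val (opponent p) (add_edge {u, v} (V, E))"
          using \<open>x \<in> ?vals\<close> moves by auto
        then show ?thesis
          using IH safe_imp_answerable[OF \<open>safe V E\<close>] Max_player by simp
      qed
      moreover have "Max ?vals \<in> ?vals"
        using \<open>finite ?vals\<close> False by (intro Max_in) simp_all
      ultimately have "Max ?vals = 0"
        by blast
      then show ?thesis
        using rec Max_player by simp
    next
      case Mini_player
      \<comment> \<open>A legal move exists here, so \<open>answerable\<close> yields a safe one; a
        single option of value 0 settles the minimum.\<close>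
      then obtain u v where "joinable V E u v" "safe V (insert {u, v} E)"
        using less.prems False moves by (auto simp: answerable_def)
      then have "?val (opponent p) (add_edge {u, v} (V, E)) = 0" "{u, v} \<in> legal_moves ?F (V, E)"
        using IH Mini_player moves by auto
      then have "0 \<in> ?vals"
        by (metis image_eqI)
      then have "Min ?vals \<le> 0"
        using \<open>finite ?vals\<close> by (intro Min_le)
      then show ?thesis
        using rec Mini_player by simp
    qed
  qed
qed

theorem theorem1p4:
  fixes n i :: nat
  assumes "n \<ge> 1" and "i \<in> {1, 2}"
  shows "sat_score i n (path_graph 6) (star_graph 4) = 0"
proof -
  \<comment> \<open>In the empty graph each vertex has its own singleton as closed set.\<close>
  have "tame {..<n} {}"
    by (auto simp: tame_def is_graph_def claw_free_def edge_closed_def intro!: exI[of _ "{_}"])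
  moreover have "ends {} = {}"
    by (simp add: ends_def)
  \<comment> \<open>The empty graph is safe for Max to start and answerable for Mini to start, which
    covers both values of \<open>i\<close>.\<close>
  ultimately have "safe {..<n} {}" "answerable {..<n} {}"
    by (auto simp: safe_def intro: answerable_no_ends)
  then show ?thesis
    by (auto simp: sat_score_def empty_graph_def intro!: game_value_eq_0)
qed

end
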